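(* Let $p$ be an odd prime, let $(\alpha,\beta)\in\mathbb{Q}_p^2$ and let $[(a_0,a_1,\ldots),(b_0,b_1,\ldots)]$ be the $p$-adic multidimensional continued fraction (MCF) expansion of $(\alpha,\beta)$. Then, for every $n\geq 0$ for which $a_n,b_n$ are defined, \[\nu_p(\alpha-Q_n^\alpha)\geq K_n+\left\lfloor \frac{n+2}{2}\right\rfloor,\qquad \nu_p(\beta-Q_n^\beta)\geq K_n+\left\lfloor \frac{n+3}{2}\right\rfloor.\]
   Context: $\nu_p$ denotes the $p$-adic valuation. Browkin's $s$-function $s:\mathbb{Q}_p\to\mathbb{Z}[1/p]\cap(-p/2,p/2)$ is defined by $s(\alpha)=\sum_{j=k}^{0}x_jp^j$, where $\alpha=\sum_{j=k}^{\infty}x_jp^j$ with $k\in\mathbb{Z}$ and $x_j\in\mathbb{Z}\cap(-p/2,p/2)$ (the sum is empty, i.e. $s(\alpha)=0$, if $k>0$). The $p$-adic Jacobi–Perron algorithm applied to $(\alpha,\beta)$ sets $\alpha_0=\alpha$, $\beta_0=\beta$ and, for $k=0,1,\ldots$: $a_k=s(\alpha_k)$, $b_k=s(\beta_k)$, and if $\beta_k\neq b_k$, $\alpha_{k+1}=1/(\beta_k-b_k)$, $\beta_{k+1}=(\alpha_k-a_k)/(\beta_k-b_k)$; if $\beta_k=b_k$ the algorithm stops. The sequences $(a_k),(b_k)$ form the $p$-adic MCF expansion $[(a_0,a_1,\ldots),(b_0,b_1,\ldots)]$ of $(\alpha,\beta)$ (finite if the algorithm stops). Define $A_{-2}=0,A_{-1}=1,A_0=a_0$;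 $B_{-2}=1,B_{-1}=0,B_0=b_0$; $C_{-2}=0,C_{-1}=0,C_0=1$, and for $n\geq1$: $A_n=a_nA_{n-1}+b_nA_{n-2}+A_{n-3}$, and the same recurrence for $B_n$ and $C_n$. The convergents are $Q_n^\alpha=A_n/C_n$, $Q_n^\beta=B_n/C_n$. For $n\geq1$ let $k_n=\nu_p(1/a_n)$ and $K_n=k_1+\cdots+k_n$, with $K_0=0$. *)

theory Defs
  imports Complex_Main "HOL-Library.Extended" "Berlekamp_Zassenhaus.Finite_Field"
begin

text \<open>The prime \<open>p\<close> is the cardinality of a type of class \<open>prime_card\<close>, so that \<open>\<rat>\<^sub>p\<close> is a type
  \<open>'p padic\<close>: the completion of \<open>rat\<close> for the \<open>p\<close>-adic valuation, constructed as Cauchy sequences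
  modulo null sequences. Valuations take values in \<open>int extended\<close>, with \<open>Pinf\<close> at 0.\<close>

definition rat_val :: "nat \<Rightarrow> rat \<Rightarrow> int extended" where
  "rat_val p x = (if x = 0 then Pinf else
     (case quotient_of x of (a, b) \<Rightarrow>
        Fin (int (multiplicity (int p) a) - int (multiplicity (int p) b))))"

lemma rat_val_0 [simp]: "rat_val p 0 = Pinf"
  by (simp add: rat_val_def)

lemma rat_val_of_int_div:
  assumes p: "prime p" and "a \<noteq> 0" "b \<noteq> 0"
  shows "rat_val p (of_int a / of_int b) =
    Fin (int (multiplicity (int p) a) - int (multiplicity (int p) b))"
proof -
  define x :: rat where "x = of_int a / of_int b"
  obtain c d where cd: "quotient_of x = (c, d)" by fastforce
  have d: "d > 0" and x: "x = of_int c / of_int d"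
    using quotient_of_denom_pos[OF cd] quotient_of_div[OF cd] by auto
  have x0: "x \<noteq> 0" using assms by (simp add: x_def)
  with x have c: "c \<noteq> 0" by auto
  have "(of_int (a * d) :: rat) = of_int (c * b)"
    using x d assms unfolding x_def by (simp add: field_simps)
  hence *: "a * d = c * b" by (simp only: of_int_eq_iff)
  have pe: "prime_elem (int p)" using p by simp
  have "multiplicity (int p) a + multiplicity (int p) d = multiplicity (int p) c + multiplicity (int p) b"
    using prime_elem_multiplicity_mult_distrib[OF pe, of a d]
          prime_elem_multiplicity_mult_distrib[OF pe, of c b] * assms c d by auto
  thus ?thesis using x0 cd unfolding rat_val_def x_def[symmetric] by simp
qed

lemma rat_val_eq_Pinf [simp]: "rat_val p x = Pinf \<longleftrightarrow> x = 0"
  by (simp add: rat_val_def split: prod.splits)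

lemma rat_val_neq_Minf [simp]: "rat_val p x \<noteq> Minf"
  by (simp add: rat_val_def split: prod.splits)

lemma rat_frac: obtains a b :: int where "b \<noteq> 0" "(x::rat) = of_int a / of_int b"
  using quotient_of_div[of x] quotient_of_denom_pos[of x]
  by (metis less_irrefl surj_pair)

lemma rat_val_1 [simp]: "prime p \<Longrightarrow> rat_val p 1 = 0"
  using rat_val_of_int_div[of p 1 1] by (simp add: zero_extended_def)

lemma rat_val_mult:
  assumes p: "prime p"
  shows "rat_val p (x * y) = rat_val p x + rat_val p y"
proof (cases "x = 0 \<or> y = 0")
  case True
  moreover have "rat_val p z + Pinf = Pinf" "Pinf + rat_val p z = Pinf" for z
    by (cases "rat_val p z"; simp)+
  ultimately show ?thesis by auto
next
  case False
  obtain a b where ab: "b \<noteq> 0" "x = of_int a / of_int b" by (rule rat_frac)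
  obtain c d where cd: "d \<noteq> 0" "y = of_int c / of_int d" by (rule rat_frac)
  have nz: "a \<noteq> 0" "c \<noteq> 0" using False ab cd by auto
  have xy: "x * y = of_int (a * c) / of_int (b * d)" using ab cd by simp
  have pe: "prime_elem (int p)" using p by simp
  show ?thesis
    unfolding xy unfolding ab(2) cd(2)
    using nz ab(1) cd(1)
    by (simp add: rat_val_of_int_div[OF p] prime_elem_multiplicity_mult_distrib[OF pe]
             del: of_int_mult)
qed

lemma rat_val_minus [simp]:
  assumes p: "prime p" shows "rat_val p (- x) = rat_val p x"
proof -
  have "rat_val p (- 1) = 0"
    using rat_val_of_int_div[OF p, of "-1" 1]
    by (simp add: zero_extended_def multiplicity_unit_right)
  thus ?thesis using rat_val_mult[OF p, of "-1" x] by simp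
qed

lemma rat_val_add:
  assumes p: "prime p" and x: "N \<le> rat_val p x" and y: "N \<le> rat_val p y"
  shows "N \<le> rat_val p (x + y)"
proof (cases "x = 0 \<or> y = 0 \<or> x + y = 0")
  case True thus ?thesis using x y by auto
next
  case False
  obtain a b where ab: "b \<noteq> 0" "x = of_int a / of_int b" by (rule rat_frac)
  obtain c d where cd: "d \<noteq> 0" "y = of_int c / of_int d" by (rule rat_frac)
  have nz: "a \<noteq> 0" "c \<noteq> 0" using False ab cd by auto
  have xy: "x + y = of_int (a * d + c * b) / of_int (b * d)"
    using ab cd by (simp add: field_simps)
  have pe: "prime_elem (int p)" using p by simp
  have nz': "a * d + c * b \<noteq> 0" using False unfolding xy by (metis div_0 of_int_0)
  let ?m = "multiplicity (int p)"
  let ?k = "min (?m (a * d)) (?m (c * b))"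
  have "int p ^ ?k dvd a * d + c * b"
    by (intro dvd_add multiplicity_dvd') auto
  hence k: "?k \<le> ?m (a * d + c * b)"
    using nz' p by (intro multiplicity_geI) (auto simp: prime_gt_1_nat dest: prime_gt_1_nat)
  have eqs: "rat_val p x = Fin (int (?m a) - int (?m b))" "rat_val p y = Fin (int (?m c) - int (?m d))"
    using nz ab cd p by (auto simp: rat_val_of_int_div)
  have s: "rat_val p (x + y) = Fin (int (?m (a*d+c*b)) - int (?m (b*d)))"
    unfolding xy using nz' ab cd by (intro rat_val_of_int_div[OF p]) auto
  have m: "?m (a*d) = ?m a + ?m d" "?m (c*b) = ?m c + ?m b" "?m (b*d) = ?m b + ?m d"
    using nz ab cd by (simp_all add: prime_elem_multiplicity_mult_distrib[OF pe])
  show ?thesis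
    using x y k unfolding s eqs m by (cases N) (auto simp: min_def split: if_splits)
qed

lemma rat_val_diff:
  assumes p: "prime p" and "N \<le> rat_val p x" "N \<le> rat_val p y"
  shows "N \<le> rat_val p (x - y)"
  using rat_val_add[OF p, of N x "- y"] assms by simp

lemma rat_val_diff_commute: "prime p \<Longrightarrow> rat_val p (x - y) = rat_val p (y - x)"
  using rat_val_minus[of p "x - y"] by simp

lemma rat_val_eqI:
  assumes p: "prime p" and "rat_val p y < rat_val p (x - y)"
  shows "rat_val p x = rat_val p y"
proof (rule antisym)
  show "rat_val p y \<le> rat_val p x"
    using rat_val_add[OF p, of "rat_val p y" y "x - y"] assms(2) by auto
  show "rat_val p x \<le> rat_val p y"
  proof (rule ccontr)
    assume "\<not> ?thesis"
    hence "rat_val p y < min (rat_val p x) (rat_val p (x - y))" using assms(2) by auto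
    also have "\<dots> \<le> rat_val p (x - (x - y))" by (rule rat_val_diff[OF p]) auto
    finally show False by simp
  qed
qed

text \<open>Convergence to 0 and the Cauchy property for the absolute value \<open>p\<close> to the power
  \<open>- rat_val p x\<close>.\<close>

definition padic_null :: "nat \<Rightarrow> (nat \<Rightarrow> rat) \<Rightarrow> bool" where
  "padic_null p X \<longleftrightarrow> (\<forall>N. \<exists>M. \<forall>n\<ge>M. Fin N \<le> rat_val p (X n))"

definition padic_Cauchy :: "nat \<Rightarrow> (nat \<Rightarrow> rat) \<Rightarrow> bool" where
  "padic_Cauchy p X \<longleftrightarrow> (\<forall>N. \<exists>M. \<forall>m\<ge>M. \<forall>n\<ge>M. Fin N \<le> rat_val p (X m - X n))"

lemma padic_null_ev:
  "padic_null p X \<longleftrightarrow> (\<forall>N. \<forall>\<^sub>F n in sequentially. Fin N \<le> rat_val p (X n))"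
  by (simp add: padic_null_def eventually_sequentially)

lemma padic_null_0 [simp]: "padic_null p (\<lambda>n. 0)"
  by (simp add: padic_null_def)

lemma padic_null_const [simp]: "padic_null p (\<lambda>n. c) \<longleftrightarrow> c = 0"
proof
  assume *: "padic_null p (\<lambda>n. c)"
  have "Fin N \<le> rat_val p c" for N using * by (auto simp: padic_null_def)
  from this show "c = 0"
  proof (cases "rat_val p c")
    case (Fin k) thus ?thesis using \<open>\<And>N. Fin N \<le> rat_val p c\<close>[of "k+1"] by simp
  qed auto
qed simp

lemma padic_null_add:
  assumes "prime p" "padic_null p X" "padic_null p Y" shows "padic_null p (\<lambda>n. X n + Y n)"
  unfolding padic_null_ev
proof
  fix N
  have "\<forall>\<^sub>F n in sequentially. Fin N \<le> rat_val p (X n)" "\<forall>\<^sub>F n in sequentially. Fin N \<le> rat_val p (Y n)"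
    using assms by (auto simp: padic_null_ev)
  thus "\<forall>\<^sub>F n in sequentially. Fin N \<le> rat_val p (X n + Y n)"
    by eventually_elim (rule rat_val_add[OF assms(1)])
qed

lemma padic_null_minus: "prime p \<Longrightarrow> padic_null p X \<Longrightarrow> padic_null p (\<lambda>n. - X n)"
  by (simp add: padic_null_def)

lemma padic_null_diff:
  assumes "prime p" "padic_null p X" "padic_null p Y" shows "padic_null p (\<lambda>n. X n - Y n)"
  using padic_null_add[OF assms(1,2) padic_null_minus[OF assms(1,3)]] by simp

lemma padic_Cauchy_const [simp]: "padic_Cauchy p (\<lambda>n. c)"
  by (simp add: padic_Cauchy_def)

lemma padic_Cauchy_add:
  assumes p: "prime p" and X: "padic_Cauchy p X" and Y: "padic_Cauchy p Y"
  shows "padic_Cauchy p (\<lambda>n. X n + Y n)"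
  unfolding padic_Cauchy_def
proof
  fix N
  obtain M where M: "\<And>m n. m \<ge> M \<Longrightarrow> n \<ge> M \<Longrightarrow> Fin N \<le> rat_val p (X m - X n)"
    using X unfolding padic_Cauchy_def by blast
  obtain M' where M': "\<And>m n. m \<ge> M' \<Longrightarrow> n \<ge> M' \<Longrightarrow> Fin N \<le> rat_val p (Y m - Y n)"
    using Y unfolding padic_Cauchy_def by blast
  have "Fin N \<le> rat_val p (X m + Y m - (X n + Y n))" if "m \<ge> max M M'" "n \<ge> max M M'" for m n
    using rat_val_add[OF p M M', of m n m n] that by (simp add: algebra_simps)
  thus "\<exists>M. \<forall>m\<ge>M. \<forall>n\<ge>M. Fin N \<le> rat_val p (X m + Y m - (X n + Y n))" by blast
qed

lemma padic_Cauchy_minus: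
  assumes p: "prime p" and X: "padic_Cauchy p X" shows "padic_Cauchy p (\<lambda>n. - X n)"
proof -
  have "rat_val p (- X m - - X n) = rat_val p (X m - X n)" for m n
    using rat_val_minus[OF p, of "X m - X n"] by simp
  thus ?thesis using X by (simp add: padic_Cauchy_def)
qed

lemma padic_Cauchy_diff:
  assumes p: "prime p" and X: "padic_Cauchy p X" and Y: "padic_Cauchy p Y"
  shows "padic_Cauchy p (\<lambda>n. X n - Y n)"
  using padic_Cauchy_add[OF p X padic_Cauchy_minus[OF p Y]] by simp

lemma padic_Cauchy_bounded:
  assumes p: "prime p" and X: "padic_Cauchy p X"
  obtains B M where "\<And>n. n \<ge> M \<Longrightarrow> Fin B \<le> rat_val p (X n)"
proof -
  obtain M where M: "\<And>m n. m \<ge> M \<Longrightarrow> n \<ge> M \<Longrightarrow> Fin 0 \<le> rat_val p (X m - X n)"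
    using X unfolding padic_Cauchy_def by blast
  obtain B where B: "Fin B \<le> rat_val p (X M)" "B \<le> 0"
  proof (cases "rat_val p (X M)")
    case (Fin k) thus ?thesis using that[of "min k 0"] by simp
  qed (auto intro: that[of 0])
  have "Fin B \<le> rat_val p (X n)" if "n \<ge> M" for n
  proof -
    have "Fin B \<le> Fin 0" using B by simp
    also have "\<dots> \<le> rat_val p (X n - X M)" using M that by simp
    finally show ?thesis using rat_val_add[OF p, of "Fin B" "X n - X M" "X M"] B by simp
  qed
  thus ?thesis by (rule that)
qed

lemma rat_val_mult_ge:
  assumes p: "prime p" and "Fin B \<le> rat_val p x" "Fin N \<le> rat_val p y"
  shows "Fin (B + N) \<le> rat_val p (x * y)"
  using add_mono[OF assms(2,3)] by (simp add: rat_val_mult[OF p])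

lemma padic_null_mult_Cauchy:
  assumes p: "prime p" and X: "padic_Cauchy p X" and Y: "padic_null p Y"
  shows "padic_null p (\<lambda>n. X n * Y n)"
  unfolding padic_null_ev
proof
  fix N
  obtain B M where B: "\<And>n. n \<ge> M \<Longrightarrow> Fin B \<le> rat_val p (X n)"
    using padic_Cauchy_bounded[OF p X] by blast
  have "\<forall>\<^sub>F n in sequentially. n \<ge> M" "\<forall>\<^sub>F n in sequentially. Fin (N - B) \<le> rat_val p (Y n)"
    using Y by (auto simp: padic_null_ev eventually_ge_at_top)
  thus "\<forall>\<^sub>F n in sequentially. Fin N \<le> rat_val p (X n * Y n)"
  proof eventually_elim
    case (elim n)
    show ?case using rat_val_mult_ge[OF p B[OF elim(1)] elim(2)] by simp
  qed
qed

lemma padic_Cauchy_mult: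
  assumes p: "prime p" and X: "padic_Cauchy p X" and Y: "padic_Cauchy p Y"
  shows "padic_Cauchy p (\<lambda>n. X n * Y n)"
  unfolding padic_Cauchy_def
proof
  fix N
  obtain B1 M1 where B1: "\<And>n. n \<ge> M1 \<Longrightarrow> Fin B1 \<le> rat_val p (X n)"
    using padic_Cauchy_bounded[OF p X] by blast
  obtain B2 M2 where B2: "\<And>n. n \<ge> M2 \<Longrightarrow> Fin B2 \<le> rat_val p (Y n)"
    using padic_Cauchy_bounded[OF p Y] by blast
  obtain M3 where M3: "\<And>m n. m \<ge> M3 \<Longrightarrow> n \<ge> M3 \<Longrightarrow> Fin (N - B2) \<le> rat_val p (X m - X n)"
    using X unfolding padic_Cauchy_def by blast
  obtain M4 where M4: "\<And>m n. m \<ge> M4 \<Longrightarrow> n \<ge> M4 \<Longrightarrow> Fin (N - B1) \<le> rat_val p (Y m - Y n)"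
    using Y unfolding padic_Cauchy_def by blast
  let ?M = "max (max M1 M2) (max M3 M4)"
  have "Fin N \<le> rat_val p (X m * Y m - X n * Y n)" if "m \<ge> ?M" "n \<ge> ?M" for m n
  proof -
    have 1: "Fin N \<le> rat_val p (X m * (Y m - Y n))"
      using rat_val_mult_ge[OF p B1[of m] M4[of m n]] that by simp
    have 2: "Fin N \<le> rat_val p ((X m - X n) * Y n)"
      using rat_val_mult_ge[OF p M3[of m n] B2[of n]] that by simp
    show ?thesis using rat_val_add[OF p 1 2] by (simp add: algebra_simps)
  qed
  thus "\<exists>M. \<forall>m\<ge>M. \<forall>n\<ge>M. Fin N \<le> rat_val p (X m * Y m - X n * Y n)" by blast
qed

lemma padic_Cauchy_not_null:
  assumes p: "prime p" and X: "padic_Cauchy p X" "\<not> padic_null p X"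
  obtains k where "\<forall>\<^sub>F n in sequentially. rat_val p (X n) = Fin k"
proof -
  obtain N where N: "\<And>M. \<exists>n\<ge>M. rat_val p (X n) < Fin N"
    using X(2) unfolding padic_null_def by (force simp: not_le)
  obtain M where M: "\<And>m n. m \<ge> M \<Longrightarrow> n \<ge> M \<Longrightarrow> Fin N \<le> rat_val p (X m - X n)"
    using X(1) unfolding padic_Cauchy_def by blast
  obtain m where m: "m \<ge> M" "rat_val p (X m) < Fin N" using N by blast
  have eq: "rat_val p (X n) = rat_val p (X m)" if "n \<ge> M" for n
    using M[OF that m(1)] m(2) by (intro rat_val_eqI[OF p]) simp
  obtain k where "rat_val p (X m) = Fin k" using m(2) by (cases "rat_val p (X m)") auto
  with eq show ?thesis by (intro that[of k]) (auto simp: eventually_sequentially)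
qed

lemma padic_Cauchy_inverse:
  assumes p: "prime p" and X: "padic_Cauchy p X" "\<not> padic_null p X"
  shows "padic_Cauchy p (\<lambda>n. inverse (X n))"
  unfolding padic_Cauchy_def
proof
  fix N
  obtain k where "\<forall>\<^sub>F n in sequentially. rat_val p (X n) = Fin k"
    by (rule padic_Cauchy_not_null[OF p X])
  then obtain M1 where M1: "\<And>n. n \<ge> M1 \<Longrightarrow> rat_val p (X n) = Fin k"
    by (auto simp: eventually_sequentially)
  obtain M2 where M2: "\<And>m n. m \<ge> M2 \<Longrightarrow> n \<ge> M2 \<Longrightarrow> Fin (N + 2 * k) \<le> rat_val p (X m - X n)"
    using X(1) unfolding padic_Cauchy_def by blast
  have "Fin N \<le> rat_val p (inverse (X m) - inverse (X n))" if mn: "m \<ge> max M1 M2" "n \<ge> max M1 M2" for m n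
  proof -
    have nz: "X m \<noteq> 0" "X n \<noteq> 0" using M1[of m] M1[of n] mn by auto
    have "X n - X m = (inverse (X m) - inverse (X n)) * (X m * X n)"
      using nz by (simp add: field_simps)
    hence "rat_val p (X n - X m) = rat_val p ((inverse (X m) - inverse (X n)) * (X m * X n))"
      by simp
    also have "\<dots> = rat_val p (inverse (X m) - inverse (X n)) + Fin (2 * k)"
      using mn by (simp add: rat_val_mult[OF p] M1)
    finally have "Fin (N + 2 * k) \<le> rat_val p (inverse (X m) - inverse (X n)) + Fin (2 * k)"
      using M2[of n m] mn by simp
    thus ?thesis by (cases "rat_val p (inverse (X m) - inverse (X n))") auto
  qed
  thus "\<exists>M. \<forall>m\<ge>M. \<forall>n\<ge>M. Fin N \<le> rat_val p (inverse (X m) - inverse (X n))" by blast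
qed

lemma padic_null_cong:
  assumes p: "prime p" and "padic_null p (\<lambda>n. X n - Y n)"
  shows "padic_null p X \<longleftrightarrow> padic_null p Y"
  using padic_null_add[OF p, of "\<lambda>n. X n - Y n" Y] padic_null_diff[OF p, of X "\<lambda>n. X n - Y n"] assms(2)
  by auto

text \<open>The valuations along a Cauchy sequence that is not null are eventually constant.\<close>

definition padic_seq_val :: "nat \<Rightarrow> (nat \<Rightarrow> rat) \<Rightarrow> int extended" where
  "padic_seq_val p X = (if padic_null p X then Pinf
     else (THE v. \<forall>\<^sub>F n in sequentially. rat_val p (X n) = v))"

lemma padic_seq_val_eqI:
  assumes "\<forall>\<^sub>F n in sequentially. rat_val p (X n) = Fin k"
  shows "padic_seq_val p X = Fin k"
proof -
  have "\<not> padic_null p X"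
  proof
    assume "padic_null p X"
    hence "\<forall>\<^sub>F n in sequentially. Fin (k + 1) \<le> rat_val p (X n)"
      by (simp add: padic_null_ev)
    with assms have "\<forall>\<^sub>F n in sequentially. False" by eventually_elim auto
    thus False by simp
  qed
  moreover have "(THE v. \<forall>\<^sub>F n in sequentially. rat_val p (X n) = v) = Fin k"
  proof (rule the_equality)
    fix v assume "\<forall>\<^sub>F n in sequentially. rat_val p (X n) = v"
    with assms have "\<forall>\<^sub>F n in sequentially. v = Fin k" by eventually_elim auto
    thus "v = Fin k" by simp
  qed (rule assms)
  ultimately show ?thesis by (simp add: padic_seq_val_def)
qed

lemma padic_seq_val_cases:
  assumes "prime p" "padic_Cauchy p X"
  obtains "padic_null p X" "padic_seq_val p X = Pinf"
    | k where "\<not> padic_null p X" "padic_seq_val p X = Fin k" "\<forall>\<^sub>F n in sequentially. rat_val p (X n) = Fin k"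
proof (cases "padic_null p X")
  case True thus ?thesis by (intro that(1)) (auto simp: padic_seq_val_def)
next
  case False
  then obtain k where "\<forall>\<^sub>F n in sequentially. rat_val p (X n) = Fin k"
    using padic_Cauchy_not_null[OF assms] by blast
  thus ?thesis using that(2) False padic_seq_val_eqI by blast
qed

lemma padic_seq_val_ge_iff:
  assumes p: "prime p" and X: "padic_Cauchy p X"
  shows "Fin N \<le> padic_seq_val p X \<longleftrightarrow> (\<forall>\<^sub>F n in sequentially. Fin N \<le> rat_val p (X n))"
  using p X
proof (cases rule: padic_seq_val_cases)
  case 1 thus ?thesis by (simp add: padic_null_ev)
next
  case (2 k)
  have "(\<forall>\<^sub>F n in sequentially. Fin N \<le> rat_val p (X n)) \<longleftrightarrow> (\<forall>\<^sub>F n in sequentially. N \<le> k)"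
    by (rule eventually_cong[OF 2(3)]) simp
  thus ?thesis using 2 by simp
qed

lemma extended_le_via_Fin:
  fixes x y :: "int extended"
  assumes "\<And>N. Fin N \<le> x \<Longrightarrow> Fin N \<le> y" "x \<noteq> Minf" "y \<noteq> Minf"
  shows "x \<le> y"
proof (cases x)
  case Pinf
  show ?thesis
  proof (cases y)
    case (Fin k) thus ?thesis using assms(1)[of "k + 1"] Pinf by simp
  qed (use assms in auto)
qed (use assms in auto)

lemma padic_seq_val_not_Minf: "prime p \<Longrightarrow> padic_Cauchy p X \<Longrightarrow> padic_seq_val p X \<noteq> Minf"
  by (rule padic_seq_val_cases) auto

lemma padic_seq_val_cong:
  assumes p: "prime p" and X: "padic_Cauchy p X" and Y: "padic_Cauchy p Y"
    and XY: "padic_null p (\<lambda>n. X n - Y n)"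
  shows "padic_seq_val p X = padic_seq_val p Y"
proof -
  have *: "padic_seq_val p X \<le> padic_seq_val p Y"
    if X: "padic_Cauchy p X" and Y: "padic_Cauchy p Y" and XY: "padic_null p (\<lambda>n. X n - Y n)" for X Y
  proof (rule extended_le_via_Fin)
    fix N assume "Fin N \<le> padic_seq_val p X"
    hence "\<forall>\<^sub>F n in sequentially. Fin N \<le> rat_val p (X n)"
      by (simp add: padic_seq_val_ge_iff[OF p X])
    moreover have "\<forall>\<^sub>F n in sequentially. Fin N \<le> rat_val p (X n - Y n)"
      using XY by (simp add: padic_null_ev)
    ultimately have "\<forall>\<^sub>F n in sequentially. Fin N \<le> rat_val p (Y n)"
    proof eventually_elim
      case (elim n) thus ?case using rat_val_diff[OF p elim] by simp
    qed
    thus "Fin N \<le> padic_seq_val p Y" by (simp add: padic_seq_val_ge_iff[OF p Y])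
  qed (use p X Y padic_seq_val_not_Minf in auto)
  show ?thesis using *[OF X Y XY] *[OF Y X] padic_null_minus[OF p XY] by simp
qed

lemma padic_seq_val_add:
  assumes p: "prime p" and X: "padic_Cauchy p X" and Y: "padic_Cauchy p Y"
  shows "min (padic_seq_val p X) (padic_seq_val p Y) \<le> padic_seq_val p (\<lambda>n. X n + Y n)"
proof (rule extended_le_via_Fin)
  fix N assume "Fin N \<le> min (padic_seq_val p X) (padic_seq_val p Y)"
  hence "\<forall>\<^sub>F n in sequentially. Fin N \<le> rat_val p (X n)" "\<forall>\<^sub>F n in sequentially. Fin N \<le> rat_val p (Y n)"
    by (simp_all add: padic_seq_val_ge_iff[OF p] X Y)
  hence "\<forall>\<^sub>F n in sequentially. Fin N \<le> rat_val p (X n + Y n)"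
    by eventually_elim (rule rat_val_add[OF p])
  thus "Fin N \<le> padic_seq_val p (\<lambda>n. X n + Y n)"
    by (simp add: padic_seq_val_ge_iff[OF p] padic_Cauchy_add[OF p X Y])
qed (use padic_seq_val_not_Minf[OF p] padic_Cauchy_add[OF p X Y] X Y in \<open>auto simp: min_def\<close>)

lemma padic_seq_val_mult:
  assumes p: "prime p" and X: "padic_Cauchy p X" and Y: "padic_Cauchy p Y"
  shows "padic_seq_val p (\<lambda>n. X n * Y n) = padic_seq_val p X + padic_seq_val p Y"
  using p X
proof (cases rule: padic_seq_val_cases)
  case 1
  have "padic_null p (\<lambda>n. X n * Y n)"
    using padic_null_mult_Cauchy[OF p Y 1(1)] by (simp add: mult.commute)
  thus ?thesis using 1 padic_seq_val_not_Minf[OF p Y]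
    by (cases "padic_seq_val p Y") (auto simp: padic_seq_val_def)
next
  case X: (2 k)
  from p Y show ?thesis
  proof (cases rule: padic_seq_val_cases)
    case 1
    have "padic_null p (\<lambda>n. X n * Y n)"
      using padic_null_mult_Cauchy[OF p assms(2) 1(1)] by simp
    thus ?thesis using 1 X by (auto simp: padic_seq_val_def)
  next
    case Y: (2 l)
    have "\<forall>\<^sub>F n in sequentially. rat_val p (X n * Y n) = Fin (k + l)"
      using X(3) Y(3) by eventually_elim (simp add: rat_val_mult[OF p])
    thus ?thesis using X Y by (simp add: padic_seq_val_eqI)
  qed
qed

typedef (overloaded) 'p padic_seq = "{X. padic_Cauchy CARD('p::prime_card) X}"
  by (rule exI[of _ "\<lambda>_. 0"]) simp

setup_lifting type_definition_padic_seq

instantiation padic_seq :: (prime_card) comm_ring_1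
begin

lift_definition zero_padic_seq :: "'a padic_seq" is "\<lambda>n. 0" by simp
lift_definition one_padic_seq :: "'a padic_seq" is "\<lambda>n. 1" by simp
lift_definition plus_padic_seq :: "'a padic_seq \<Rightarrow> 'a padic_seq \<Rightarrow> 'a padic_seq"
  is "\<lambda>X Y n. X n + Y n" by (rule padic_Cauchy_add[OF prime_card])
lift_definition uminus_padic_seq :: "'a padic_seq \<Rightarrow> 'a padic_seq"
  is "\<lambda>X n. - X n" by (rule padic_Cauchy_minus[OF prime_card])
lift_definition minus_padic_seq :: "'a padic_seq \<Rightarrow> 'a padic_seq \<Rightarrow> 'a padic_seq"
  is "\<lambda>X Y n. X n - Y n" by (rule padic_Cauchy_diff[OF prime_card])
lift_definition times_padic_seq :: "'a padic_seq \<Rightarrow> 'a padic_seq \<Rightarrow> 'a padic_seq"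
  is "\<lambda>X Y n. X n * Y n" by (rule padic_Cauchy_mult[OF prime_card])

instance
  by standard (transfer; simp add: fun_eq_iff algebra_simps)+

end

lift_definition padic_seq_inverse :: "'p::prime_card padic_seq \<Rightarrow> 'p padic_seq"
  is "\<lambda>X. if padic_null CARD('p) X then (\<lambda>n. 0) else (\<lambda>n. inverse (X n))"
  by (simp add: padic_Cauchy_inverse[OF prime_card])

lift_definition padic_rel :: "'p::prime_card padic_seq \<Rightarrow> 'p padic_seq \<Rightarrow> bool"
  is "\<lambda>X Y. padic_null CARD('p) (\<lambda>n. X n - Y n)" .

lemma equivp_padic_rel: "equivp (padic_rel :: 'p::prime_card padic_seq \<Rightarrow> _)"
proof (rule equivpI)
  show "reflp (padic_rel :: 'p padic_seq \<Rightarrow> _)"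
    by (rule reflpI; transfer) simp
  show "symp (padic_rel :: 'p padic_seq \<Rightarrow> _)"
    by (rule sympI; transfer) (drule padic_null_minus[OF prime_card], simp)
  show "transp (padic_rel :: 'p padic_seq \<Rightarrow> _)"
    by (rule transpI; transfer) (drule (1) padic_null_add[OF prime_card], simp)
qed

quotient_type (overloaded) 'p padic = "'p::prime_card padic_seq" / padic_rel
  by (rule equivp_padic_rel)

instantiation padic :: (prime_card) field
begin

lift_definition zero_padic :: "'a padic" is 0 .
lift_definition one_padic :: "'a padic" is 1 .

lift_definition plus_padic :: "'a padic \<Rightarrow> 'a padic \<Rightarrow> 'a padic" is "(+)"
proof (transfer, goal_cases)
  case (1 X X' Y Y')
  show ?case using padic_null_add[OF prime_card 1(5,6)] by (simp add: algebra_simps)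
qed

lift_definition uminus_padic :: "'a padic \<Rightarrow> 'a padic" is uminus
proof (transfer, goal_cases)
  case (1 X X')
  show ?case using padic_null_minus[OF prime_card 1(3)] by (simp add: algebra_simps)
qed

lift_definition minus_padic :: "'a padic \<Rightarrow> 'a padic \<Rightarrow> 'a padic" is "(-)"
proof (transfer, goal_cases)
  case (1 X X' Y Y')
  show ?case using padic_null_diff[OF prime_card 1(5,6)] by (simp add: algebra_simps)
qed

lift_definition times_padic :: "'a padic \<Rightarrow> 'a padic \<Rightarrow> 'a padic" is "(*)"
proof (transfer, goal_cases)
  case (1 X X' Y Y')
  show ?case
    using padic_null_add[OF prime_card padic_null_mult_Cauchy[OF prime_card 1(1,6)]
        padic_null_mult_Cauchy[OF prime_card 1(4,5)]]
    by (simp add: algebra_simps)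
qed

lift_definition inverse_padic :: "'a padic \<Rightarrow> 'a padic" is padic_seq_inverse
proof (transfer, goal_cases)
  case (1 X Y)
  show ?case
  proof (cases "padic_null CARD('a) X")
    case True
    thus ?thesis using padic_null_cong[OF prime_card 1(3)] by simp
  next
    case X: False
    hence Y: "\<not> padic_null CARD('a) Y" using padic_null_cong[OF prime_card 1(3)] by simp
    obtain k where k: "\<forall>\<^sub>F n in sequentially. rat_val CARD('a) (X n) = Fin k"
      using padic_Cauchy_not_null[OF prime_card 1(1) X] .
    obtain l where l: "\<forall>\<^sub>F n in sequentially. rat_val CARD('a) (Y n) = Fin l"
      using padic_Cauchy_not_null[OF prime_card 1(2) Y] .
    have "\<forall>\<^sub>F n in sequentially. inverse (X n) - inverse (Y n) = inverse (X n) * (inverse (Y n) * - (X n - Y n))"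
      using k l
    proof eventually_elim
      case (elim n)
      hence "X n \<noteq> 0" "Y n \<noteq> 0" by auto
      thus ?case by (simp add: field_simps)
    qed
    moreover have "padic_null CARD('a) (\<lambda>n. inverse (X n) * (inverse (Y n) * - (X n - Y n)))"
      by (intro padic_null_mult_Cauchy padic_null_minus padic_Cauchy_inverse prime_card 1 X Y)
    ultimately have "padic_null CARD('a) (\<lambda>n. inverse (X n) - inverse (Y n))"
      by (auto simp: padic_null_ev elim: eventually_elim2)
    thus ?thesis using X Y by simp
  qed
qed

definition divide_padic :: "'a padic \<Rightarrow> 'a padic \<Rightarrow> 'a padic" where
  "divide_padic x y = x * inverse y"

instance
proof
  fix a b c :: "'a padic"
  have refl: "padic_rel X X" for X :: "'a padic_seq"
    using equivp_padic_rel by (rule equivp_reflp)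
  have eq: "X = Y \<Longrightarrow> padic_rel X Y" for X Y :: "'a padic_seq" using refl by simp
  show "a + b + c = a + (b + c)" by transfer (rule eq, simp add: algebra_simps)
  show "a + b = b + a" by transfer (rule eq, simp add: algebra_simps)
  show "0 + a = a" by transfer (rule eq, simp)
  show "- a + a = 0" by transfer (rule eq, simp)
  show "a - b = a + - b" by transfer (rule eq, simp)
  show "a * b * c = a * (b * c)" by transfer (rule eq, simp add: algebra_simps)
  show "a * b = b * a" by transfer (rule eq, simp add: algebra_simps)
  show "1 * a = a" by transfer (rule eq, simp)
  show "(a + b) * c = a * c + b * c" by transfer (rule eq, simp add: algebra_simps)
  show "(0::'a padic) \<noteq> 1" by (transfer, transfer) simp
  show "inverse (0::'a padic) = 0" by (transfer, transfer) simp
  show "a div b = a * inverse b" by (rule divide_padic_def)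
  show "inverse a * a = 1" if "a \<noteq> 0"
    using that
  proof (transfer, transfer, goal_cases)
    case (1 X)
    hence nz: "\<not> padic_null CARD('a) X" by simp
    obtain k where k: "\<forall>\<^sub>F n in sequentially. rat_val CARD('a) (X n) = Fin k"
      using padic_Cauchy_not_null[OF prime_card 1(1) nz] .
    have "\<forall>\<^sub>F n in sequentially. inverse (X n) * X n - 1 = 0"
      using k
    proof eventually_elim
      case (elim n)
      hence "X n \<noteq> 0" by auto
      thus ?case by simp
    qed
    hence "padic_null CARD('a) (\<lambda>n. inverse (X n) * X n - 1)"
      unfolding padic_null_ev by (auto elim: eventually_mono)
    thus ?case using nz by simp
  qed
qed

end

lift_definition padic_val :: "'p::prime_card padic \<Rightarrow> int extended"
  is "\<lambda>X. padic_seq_val CARD('p) (Rep_padic_seq X)"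
  by (transfer) (rule padic_seq_val_cong[OF prime_card])

lemma padic_val_eq_Pinf_iff [simp]: "padic_val x = Pinf \<longleftrightarrow> x = 0"
  for x :: "'p::prime_card padic"
proof (transfer, transfer, goal_cases)
  case (1 X)
  from prime_card 1 show ?case by (cases rule: padic_seq_val_cases) auto
qed

lemma padic_val_0 [simp]: "padic_val 0 = Pinf"
  by simp

lemma padic_val_not_Minf [simp]: "padic_val x \<noteq> Minf"
  by (transfer, transfer) (rule padic_seq_val_not_Minf[OF prime_card])

lemma padic_val_mult: "padic_val (x * y) = padic_val x + padic_val y"
  by (transfer, transfer) (rule padic_seq_val_mult[OF prime_card])

lemma padic_val_add: "min (padic_val x) (padic_val y) \<le> padic_val (x + y)"
  by (transfer, transfer) (rule padic_seq_val_add[OF prime_card])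

lemma padic_val_1 [simp]: "padic_val 1 = 0"
proof (transfer, transfer)
  show "padic_seq_val CARD('a) (\<lambda>n. 1) = 0"
    using padic_seq_val_eqI[of "CARD('a)" "\<lambda>_. 1" 0] rat_val_1[OF prime_card[where 'a='a]]
    by (simp add: zero_extended_def)
qed

lemma padic_val_minus [simp]: "padic_val (- x) = padic_val x"
proof -
  have "padic_val (- 1 :: 'a padic) + padic_val (- 1 :: 'a padic) = Fin 0"
    by (simp flip: padic_val_mult zero_extended_def)
  hence "padic_val (- 1 :: 'a padic) = 0"
    by (cases "padic_val (- 1 :: 'a padic)") (auto simp: zero_extended_def)
  thus ?thesis using padic_val_mult[of "-1" x] by simp
qed

lemma padic_of_nat: "(of_nat n :: 'p::prime_card padic) = abs_padic (Abs_padic_seq (\<lambda>_. of_nat n))"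
proof (induction n)
  case 0
  show ?case by (simp add: zero_padic_seq_def zero_padic_def)
next
  case (Suc n)
  have "(of_nat (Suc n) :: 'p padic) = abs_padic (Abs_padic_seq (\<lambda>_. 1)) + of_nat n"
    by (simp add: one_padic_def one_padic_seq_def)
  also have "\<dots> = abs_padic (Abs_padic_seq (\<lambda>_. of_nat (Suc n)))"
    unfolding Suc by (simp add: plus_padic.abs_eq plus_padic_seq.abs_eq eq_onp_def)
  finally show ?case .
qed

instance padic :: (prime_card) field_char_0
proof
  show "inj (of_nat :: nat \<Rightarrow> 'a padic)"
    by (rule injI) (simp add: padic_of_nat padic.abs_eq_iff padic_rel.abs_eq eq_onp_def)
qed

lemma padic_val_of_nat: "padic_val (of_nat n :: 'p::prime_card padic) = rat_val CARD('p) (of_nat n)"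
proof (cases "n = 0")
  case False
  then obtain k where "rat_val CARD('p) (of_nat n) = Fin k"
    by (cases "rat_val CARD('p) (of_nat n)") auto
  thus ?thesis using padic_seq_val_eqI[of "CARD('p)" "\<lambda>_. of_nat n" k]
    by (simp add: padic_of_nat padic_val.abs_eq Abs_padic_seq_inverse)
qed simp

lemma padic_val_of_rat: "padic_val (of_rat q :: 'p::prime_card padic) = rat_val CARD('p) q"
proof -
  have p: "prime CARD('p)" by (rule prime_card)
  have int: "padic_val (of_int a :: 'p padic) = rat_val CARD('p) (of_int a)" for a
    by (cases a rule: int_cases2) (simp_all add: padic_val_of_nat rat_val_minus[OF p])
  obtain a b where ab: "b \<noteq> 0" "q = of_int a / of_int b" by (rule rat_frac)
  have "padic_val (of_rat q * of_int b :: 'p padic) = rat_val CARD('p) (q * of_int b)"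
    using ab by (simp add: of_rat_divide int)
  hence "padic_val (of_rat q :: 'p padic) + rat_val CARD('p) (of_int b)
      = rat_val CARD('p) q + rat_val CARD('p) (of_int b)"
    by (simp add: padic_val_mult rat_val_mult[OF p] int)
  moreover obtain l where "rat_val CARD('p) (of_int b) = Fin l"
    using ab by (cases "rat_val CARD('p) (of_int b)") auto
  ultimately show ?thesis
    by (cases "padic_val (of_rat q :: 'p padic)"; cases "rat_val CARD('p) q") auto
qed

definition padic_abs :: "'p::prime_card padic \<Rightarrow> real" where
  "padic_abs x = (case padic_val x of Fin k \<Rightarrow> real CARD('p) powi (- k) | _ \<Rightarrow> 0)"

lemma padic_abs_add: "padic_abs (x + y) \<le> max (padic_abs x) (padic_abs y)"
  for x y :: "'p::prime_card padic"
proof -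
  have p: "1 < real CARD('p)" using prime_gt_1_nat[OF prime_card[where 'a='p]] by simp
  have mono: "padic_abs u \<le> padic_abs v" if "padic_val v \<le> padic_val u" for u v :: "'p padic"
    using that p padic_val_not_Minf[of u] padic_val_not_Minf[of v]
    by (auto simp: padic_abs_def power_int_increasing split: extended.splits simp del: padic_val_not_Minf)
  show ?thesis
    using padic_val_add[of x y] mono[of x "x + y"] mono[of y "x + y"]
    by (auto simp: min_def max_def split: if_splits)
qed

instantiation padic :: (prime_card) metric_space
begin

definition dist_padic :: "'a padic \<Rightarrow> 'a padic \<Rightarrow> real" where
  "dist_padic x y = padic_abs (x - y)"

definition uniformity_padic :: "('a padic \<times> 'a padic) filter" where
  "uniformity_padic = (INF e\<in>{0<..}. principal {(x, y). dist x y < e})"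

definition open_padic :: "'a padic set \<Rightarrow> bool" where
  "open_padic U \<longleftrightarrow> (\<forall>x\<in>U. eventually (\<lambda>(x', y). x' = x \<longrightarrow> y \<in> U) uniformity)"

instance
proof
  fix x y z :: "'a padic"
  have p: "1 < real CARD('a)" using prime_gt_1_nat[OF prime_card[where 'a='a]] by simp
  have nonneg: "0 \<le> padic_abs u" for u :: "'a padic"
    using p by (auto simp: padic_abs_def split: extended.splits)
  show "dist x y = 0 \<longleftrightarrow> x = y"
    using p padic_val_not_Minf[of "x - y"] padic_val_eq_Pinf_iff[of "x - y"]
    by (auto simp: dist_padic_def padic_abs_def split: extended.splits
          simp del: padic_val_not_Minf padic_val_eq_Pinf_iff)
  have "padic_abs (x - y) \<le> max (padic_abs (x - z)) (padic_abs (z - y))"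
    using padic_abs_add[of "x - z" "z - y"] by simp
  moreover have "padic_abs (z - y) = padic_abs (y - z)"
    using padic_val_minus[of "z - y"] by (simp add: padic_abs_def)
  ultimately show "dist x y \<le> dist x z + dist y z"
    using nonneg[of "x - z"] nonneg[of "y - z"] by (simp add: dist_padic_def)
qed (simp_all add: uniformity_padic_def open_padic_def)

end

text \<open>The series converges in the \<open>p\<close>-adic metric. Leading digits may be 0, so \<open>k\<close> is not determined
  by \<open>\<alpha>\<close>; for odd \<open>p\<close> the truncation at exponent 0 in \<open>browkin_s\<close> is. The values of Browkin's
  function, elements of \<open>\<int>[1/p]\<close>, are taken inside \<open>\<rat>\<^sub>p\<close>.\<close>

definition signed_expansion :: "'p::prime_card padic \<Rightarrow> int \<Rightarrow> (int \<Rightarrow> int) \<Rightarrow> bool" where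
  "signed_expansion \<alpha> k x \<longleftrightarrow>
     (\<forall>j\<ge>k. - real CARD('p) / 2 < real_of_int (x j) \<and> real_of_int (x j) < real CARD('p) / 2) \<and>
     (\<lambda>i. of_int (x (k + int i)) * of_nat CARD('p) powi (k + int i)) sums \<alpha>"

definition browkin_s :: "'p::prime_card padic \<Rightarrow> 'p padic" where
  "browkin_s \<alpha> = (THE y. \<exists>k x. signed_expansion \<alpha> k x \<and>
     y = (\<Sum>j=k..0. of_int (x j) * of_nat CARD('p) powi j))"

text \<open>\<open>jp_state \<alpha> \<beta> k\<close> is the pair of \<open>k\<close>-th complete quotients, and \<open>None\<close> once the algorithm has
  stopped. Consequently \<open>mcf_a\<close> and \<open>mcf_b\<close> are meaningful only where \<open>mcf_defined\<close> holds.\<close>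

primrec jp_state ::
  "'p::prime_card padic \<Rightarrow> 'p padic \<Rightarrow> nat \<Rightarrow> ('p padic \<times> 'p padic) option" where
  "jp_state \<alpha> \<beta> 0 = Some (\<alpha>, \<beta>)"
| "jp_state \<alpha> \<beta> (Suc k) =
     (case jp_state \<alpha> \<beta> k of
        None \<Rightarrow> None
      | Some (x, y) \<Rightarrow>
          if y = browkin_s y then None
          else Some (1 / (y - browkin_s y), (x - browkin_s x) / (y - browkin_s y)))"

definition mcf_defined :: "'p::prime_card padic \<Rightarrow> 'p padic \<Rightarrow> nat \<Rightarrow> bool" where
  "mcf_defined \<alpha> \<beta> n \<longleftrightarrow> jp_state \<alpha> \<beta> n \<noteq> None"

definition mcf_a :: "'p::prime_card padic \<Rightarrow> 'p padic \<Rightarrow> nat \<Rightarrow> 'p padic" where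
  "mcf_a \<alpha> \<beta> n = browkin_s (fst (the (jp_state \<alpha> \<beta> n)))"

definition mcf_b :: "'p::prime_card padic \<Rightarrow> 'p padic \<Rightarrow> nat \<Rightarrow> 'p padic" where
  "mcf_b \<alpha> \<beta> n = browkin_s (snd (the (jp_state \<alpha> \<beta> n)))"

text \<open>The index is shifted by 2: \<open>mcf_rec a b x y z (n + 2)\<close> is the \<open>n\<close>-th term of the
  sequence with terms \<open>x\<close>, \<open>y\<close>, \<open>z\<close> at the indices -2, -1, 0.\<close>

fun mcf_rec :: "(nat \<Rightarrow> 'a) \<Rightarrow> (nat \<Rightarrow> 'a) \<Rightarrow> 'a \<Rightarrow> 'a \<Rightarrow> 'a \<Rightarrow> nat \<Rightarrow> 'a::comm_ring_1" where
  "mcf_rec a b x y z 0 = x"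
| "mcf_rec a b x y z (Suc 0) = y"
| "mcf_rec a b x y z (Suc (Suc 0)) = z"
| "mcf_rec a b x y z (Suc (Suc (Suc n))) =
     a (Suc n) * mcf_rec a b x y z (Suc (Suc n))
     + b (Suc n) * mcf_rec a b x y z (Suc n) + mcf_rec a b x y z n"

definition mcf_A :: "'p::prime_card padic \<Rightarrow> 'p padic \<Rightarrow> nat \<Rightarrow> 'p padic" where
  "mcf_A \<alpha> \<beta> n = mcf_rec (mcf_a \<alpha> \<beta>) (mcf_b \<alpha> \<beta>) 0 1 (mcf_a \<alpha> \<beta> 0) (n + 2)"

definition mcf_B :: "'p::prime_card padic \<Rightarrow> 'p padic \<Rightarrow> nat \<Rightarrow> 'p padic" where
  "mcf_B \<alpha> \<beta> n = mcf_rec (mcf_a \<alpha> \<beta>) (mcf_b \<alpha> \<beta>) 1 0 (mcf_b \<alpha> \<beta> 0) (n + 2)"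

definition mcf_C :: "'p::prime_card padic \<Rightarrow> 'p padic \<Rightarrow> nat \<Rightarrow> 'p padic" where
  "mcf_C \<alpha> \<beta> n = mcf_rec (mcf_a \<alpha> \<beta>) (mcf_b \<alpha> \<beta>) 0 0 1 (n + 2)"

definition convergent_alpha :: "'p::prime_card padic \<Rightarrow> 'p padic \<Rightarrow> nat \<Rightarrow> 'p padic" where
  "convergent_alpha \<alpha> \<beta> n = mcf_A \<alpha> \<beta> n / mcf_C \<alpha> \<beta> n"

definition convergent_beta :: "'p::prime_card padic \<Rightarrow> 'p padic \<Rightarrow> nat \<Rightarrow> 'p padic" where
  "convergent_beta \<alpha> \<beta> n = mcf_B \<alpha> \<beta> n / mcf_C \<alpha> \<beta> n"

definition mcf_K :: "'p::prime_card padic \<Rightarrow> 'p padic \<Rightarrow> nat \<Rightarrow> int extended" where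
  "mcf_K \<alpha> \<beta> n = (\<Sum>i=1..n. padic_val (1 / mcf_a \<alpha> \<beta> i))"

end

theory Submission
  imports Defs "HOL-Number_Theory.Cong"
begin

text \<open>Every \<open>x\<close> in \<open>\<rat>\<^sub>p\<close> agrees with \<open>s(x)\<close> modulo \<open>p\<close>. For the residuals
  \<open>V\<^sub>n = A\<^sub>n - \<alpha> C\<^sub>n\<close> and \<open>V\<^sub>n = B\<^sub>n - \<beta> C\<^sub>n\<close> the recurrence becomes
  \<open>V\<^sub>n = (a\<^sub>n - \<alpha>\<^sub>n) V\<^bsub>n-1\<^esub> + (b\<^sub>n - \<beta>\<^sub>n) V\<^bsub>n-2\<^esub>\<close>, whose coefficients have valuation at least 1,
  so the valuation of \<open>V\<^sub>n\<close> grows by at least 1 every two steps. Since the valuation of \<open>b\<^sub>n\<close>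
  exceeds that of \<open>a\<^sub>n\<close> for positive \<open>n\<close>, the term \<open>a\<^sub>n C\<^bsub>n-1\<^esub>\<close> dominates the recurrence of
  \<open>C\<^sub>n\<close>, which therefore has valuation exactly \<open>- K\<^sub>n\<close>; dividing by \<open>C\<^sub>n\<close> gives the bounds.\<close>

section \<open>Valuations in the field of \<open>p\<close>-adic numbers\<close>

lemma padic_val_ge_add:
  "N \<le> padic_val x \<Longrightarrow> N \<le> padic_val y \<Longrightarrow> N \<le> padic_val (x + y)"
  using padic_val_add[of x y] by (meson min.boundedI order_trans)

lemma padic_val_diff_commute: "padic_val (x - y) = padic_val (y - x)"
  using padic_val_minus[of "x - y"] by simp

lemma padic_val_ge_diff:
  "N \<le> padic_val x \<Longrightarrow> N \<le> padic_val y \<Longrightarrow> N \<le> padic_val (x - y)"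
  using padic_val_ge_add[of N x "- y"] by simp

lemma padic_val_ge_sum:
  "(\<And>i. i \<in> I \<Longrightarrow> N \<le> padic_val (f i)) \<Longrightarrow> N \<le> padic_val (\<Sum>i\<in>I. f i)"
  by (induction I rule: infinite_finite_induct) (auto intro: padic_val_ge_add)

lemma padic_val_ge_mult:
  "Fin M \<le> padic_val x \<Longrightarrow> Fin N \<le> padic_val y \<Longrightarrow> Fin (M + N) \<le> padic_val (x * y)"
  using add_mono[of "Fin M" "padic_val x" "Fin N" "padic_val y"] by (simp add: padic_val_mult)

text \<open>If \<open>x\<close> had larger valuation than \<open>y\<close>, then
  \<open>y = x - (x - y)\<close> would be a difference of two terms of valuation above its own. This
  isolates dominant terms below.\<close>

lemma padic_val_eqI:
  assumes "padic_val y < padic_val (x - y)"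
  shows "padic_val x = padic_val y"
proof (rule antisym)
  show "padic_val y \<le> padic_val x"
    using padic_val_ge_add[of "padic_val y" y "x - y"] assms by auto
  show "padic_val x \<le> padic_val y"
  proof (rule ccontr)
    assume "\<not> ?thesis"
    hence "padic_val y < min (padic_val x) (padic_val (x - y))" using assms by auto
    also have "\<dots> \<le> padic_val (x - (x - y))" by (rule padic_val_ge_diff) auto
    finally show False by simp
  qed
qed

lemma padic_val_nonzero:
  assumes "x \<noteq> 0"
  obtains k where "padic_val x = Fin k"
  using assms by (cases "padic_val x") auto

lemma padic_val_inverse:
  assumes "padic_val x = Fin k"
  shows "padic_val (inverse x) = Fin (- k)"
proof -
  have "x \<noteq> 0" using assms by auto
  hence "padic_val x + padic_val (inverse x) = Fin 0"
    by (simp flip: padic_val_mult zero_extended_def)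
  thus ?thesis using assms by (cases "padic_val (inverse x)") auto
qed

lemma padic_val_of_int:
  assumes "n \<noteq> 0"
  shows "padic_val (of_int n :: 'p::prime_card padic) = Fin (int (multiplicity (int CARD('p)) n))"
  using padic_val_of_rat[of "of_int n", where 'p='p] assms
    rat_val_of_int_div[OF prime_card[where 'a='p], of n 1] by simp

lemma padic_val_of_int_nonneg: "Fin 0 \<le> padic_val (of_int n)"
  by (cases "n = 0") (simp_all add: padic_val_of_int)

lemma power_dvd_if_padic_val_ge:
  assumes "Fin (int k) \<le> padic_val (of_int n :: 'p::prime_card padic)"
  shows "int CARD('p) ^ k dvd n"
  using assms by (cases "n = 0") (auto simp: padic_val_of_int intro: multiplicity_dvd')

lemma padic_val_of_int_ge_1:
  assumes "int CARD('p) dvd n"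
  shows "Fin 1 \<le> padic_val (of_int n :: 'p::prime_card padic)"
proof (cases "n = 0")
  case False
  have "1 \<le> multiplicity (int CARD('p)) n"
    using assms False prime_gt_1_nat[OF prime_card[where 'a='p]] by (intro multiplicity_geI) auto
  thus ?thesis using False by (simp add: padic_val_of_int)
qed simp

lemma padic_val_p: "padic_val (of_nat CARD('p) :: 'p::prime_card padic) = Fin 1"
  using padic_val_of_int[of "int CARD('p)", where 'p='p]
    prime_gt_1_nat[OF prime_card[where 'a='p]] by (simp add: multiplicity_self)

lemma padic_val_p_power: "padic_val (of_nat CARD('p) ^ k :: 'p::prime_card padic) = Fin (int k)"
  by (induction k) (simp_all add: padic_val_mult padic_val_p zero_extended_def)

lemma padic_val_p_powi: "padic_val (of_nat CARD('p) powi k :: 'p::prime_card padic) = Fin k"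
proof (cases "k \<ge> 0")
  case True
  thus ?thesis by (simp add: power_int_def padic_val_p_power)
next
  case False
  have "padic_val (inverse (of_nat CARD('p) ^ nat (- k)) :: 'p padic) = Fin (- int (nat (- k)))"
    by (rule padic_val_inverse[OF padic_val_p_power])
  thus ?thesis using False by (simp add: power_int_def power_inverse)
qed

text \<open>Bridge between the metric, in which \<open>signed_expansion\<close> sums its series, and
  valuations. It rests on strict monotonicity of powers of \<open>p > 1\<close>; valuation
  \<open>Pinf\<close> corresponds to distance 0.\<close>

lemma dist_padic_le_iff:
  "dist x y \<le> real CARD('p) powi (- N) \<longleftrightarrow> Fin N \<le> padic_val (x - y)"
  for x y :: "'p::prime_card padic"
proof -
  have p: "1 < real CARD('p)" using prime_gt_1_nat[OF prime_card[where 'a='p]] by simp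
  show ?thesis
  proof (cases "padic_val (x - y)")
    case (Fin k)
    show ?thesis
      using Fin p power_int_increasing[of "- k" "- N" "real CARD('p)"]
        power_int_strict_increasing[of "- N" "- k" "real CARD('p)"]
      by (cases "N \<le> k") (auto simp: dist_padic_def padic_abs_def)
  qed (use p in \<open>auto simp: dist_padic_def padic_abs_def\<close>)
qed

section \<open>Signed expansions\<close>

lift_definition padic_const :: "rat \<Rightarrow> 'p::prime_card padic_seq" is "\<lambda>q _. q" by simp

text \<open>Gives \<open>of_rat q\<close>, which comes from the field structure, an explicit
  representative. The map \<open>\<phi>\<close> is multiplicative and agrees with
  \<open>of_int\<close> on integers, so clearing the denominator of \<open>q\<close> determines
  it.\<close>

lemma abs_padic_const: "abs_padic (padic_const q) = (of_rat q :: 'p::prime_card padic)"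
proof -
  define \<phi> :: "rat \<Rightarrow> 'p padic" where "\<phi> q = abs_padic (padic_const q)" for q
  have mult: "\<phi> (x * y) = \<phi> x * \<phi> y" for x y
  proof -
    have "padic_const (x * y) = (padic_const x * padic_const y :: 'p padic_seq)"
      by transfer simp
    thus ?thesis by (simp add: \<phi>_def times_padic.abs_eq)
  qed
  have minus: "\<phi> (- x) = - \<phi> x" for x
  proof -
    have "padic_const (- x) = (- padic_const x :: 'p padic_seq)" by transfer simp
    thus ?thesis by (simp add: \<phi>_def uminus_padic.abs_eq)
  qed
  have nat: "\<phi> (of_nat n) = of_nat n" for n
    by (simp add: \<phi>_def padic_of_nat padic_const_def)
  have int: "\<phi> (of_int n) = of_int n" for n
    by (cases n rule: int_cases2) (simp_all add: nat minus)
  obtain a b where ab: "b \<noteq> 0" "q = of_int a / of_int b" by (rule rat_frac)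
  have "\<phi> q * of_int b = of_int a"
    using ab mult[of q "of_int b"] by (simp add: int)
  hence "\<phi> q = of_int a / of_int b" using ab(1) by (simp add: field_simps)
  thus ?thesis by (simp add: \<phi>_def ab(2) of_rat_divide)
qed

text \<open>Density of the rationals: a sufficiently late term of a Cauchy sequence representing
  \<open>x\<close> serves as \<open>q\<close>.\<close>

lemma padic_rat_approx: "\<exists>q. Fin N \<le> padic_val (x - of_rat q)" for x :: "'p::prime_card padic"
proof -
  obtain X where x: "x = abs_padic X" by (metis Quotient3_abs_rep[OF Quotient3_padic])
  define Y where "Y = Rep_padic_seq X"
  have Y: "padic_Cauchy CARD('p) Y" using Rep_padic_seq[of X] by (simp add: Y_def)
  obtain M where M: "\<And>m n. m \<ge> M \<Longrightarrow> n \<ge> M \<Longrightarrow> Fin N \<le> rat_val CARD('p) (Y m - Y n)"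
    using Y unfolding padic_Cauchy_def by blast
  have C: "padic_Cauchy CARD('p) (\<lambda>n. Y n - Y M)"
    by (intro padic_Cauchy_diff[OF prime_card] Y) simp
  have "padic_val (x - of_rat (Y M)) = padic_seq_val CARD('p) (\<lambda>n. Y n - Y M)"
    by (simp add: x Y_def minus_padic.abs_eq padic_val.abs_eq minus_padic_seq.rep_eq
        padic_const.rep_eq flip: abs_padic_const)
  moreover have "Fin N \<le> padic_seq_val CARD('p) (\<lambda>n. Y n - Y M)"
    using M by (auto simp: padic_seq_val_ge_iff[OF prime_card C] eventually_sequentially)
  ultimately show ?thesis by metis
qed

lemma odd_symmetric_residue:
  fixes n p :: int
  assumes "odd p" "p > 0"
  obtains d where "2 * \<bar>d\<bar> < p" "p dvd n - d"
proof
  define h where "h = p div 2"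
  \<comment> \<open>With \<open>p = 2 * h + 1\<close> the remainder lies between 0 and
    \<open>2 * h\<close>; shifting back by \<open>h\<close> centres it at 0.\<close>
  let ?d = "(n + h) mod p - h"
  have "p = 2 * h + 1" using assms unfolding h_def by presburger
  moreover have "0 \<le> (n + h) mod p" "(n + h) mod p < p" using assms by simp_all
  ultimately show "2 * \<bar>?d\<bar> < p" by (simp add: abs_if)
  have "n - ?d = p * ((n + h) div p)" by (simp add: minus_mod_eq_mult_div [symmetric])
  thus "p dvd n - ?d" by simp
qed

text \<open>The residue field has \<open>p\<close> elements: a rational \<open>q = a / b\<close>
  close to \<open>x\<close> has denominator prime to \<open>p\<close>, and the symmetric residue of
  \<open>a\<close> times an inverse of \<open>b\<close> modulo \<open>p\<close> is the
  digit.\<close>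

lemma padic_signed_digit:
  fixes x :: "'p::prime_card padic"
  assumes p: "odd CARD('p)" and x: "Fin 0 \<le> padic_val x"
  shows "\<exists>d::int. 2 * \<bar>d\<bar> < int CARD('p) \<and> Fin 1 \<le> padic_val (x - of_int d)"
proof -
  let ?p = "int CARD('p)"
  have prime: "prime ?p" using prime_card[where 'a='p] by simp
  obtain q where q: "Fin 1 \<le> padic_val (x - of_rat q)" using padic_rat_approx by blast
  have "Fin 0 \<le> padic_val (x - (x - of_rat q))"
    using x order_trans[OF _ q, of "Fin 0"] by (rule padic_val_ge_diff) simp
  hence q0: "Fin 0 \<le> rat_val CARD('p) q" by (simp add: padic_val_of_rat)
  obtain a b where ab: "quotient_of q = (a, b)" by fastforce
  have b: "b > 0" "coprime a b" "q = of_int a / of_int b"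
    using quotient_of_denom_pos[OF ab] quotient_of_coprime[OF ab] quotient_of_div[OF ab] by auto
  have "\<not> ?p dvd b"
  proof
    assume dvd: "?p dvd b"
    hence "\<not> ?p dvd a" using b(2) prime by (meson not_coprimeI not_prime_unit)
    hence "a \<noteq> 0" "multiplicity ?p a = 0" by (auto simp: not_dvd_imp_multiplicity_0)
    moreover have "multiplicity ?p b \<ge> 1"
      using dvd b prime by (intro multiplicity_geI) (auto simp: prime_gt_1_int)
    ultimately show False
      using q0 b rat_val_of_int_div[OF prime_card[where 'a='p], of a b] by auto
  qed
  hence "coprime b ?p" using prime prime_imp_coprime coprime_commute by blast
  then obtain c where c: "[b * c = 1] (mod ?p)" using cong_solve_coprime_int by blast
  obtain d where d: "2 * \<bar>d\<bar> < ?p" "?p dvd a * c - d"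
    using odd_symmetric_residue[of ?p "a * c"] p prime by (auto simp: prime_gt_0_int)
  \<comment> \<open>The identity is
    \<open>a - b * d = b * (a * c - d) - a * (b * c - 1)\<close>.\<close>
  have "?p dvd a - b * d"
  proof -
    have "?p dvd b * c - 1" using c by (simp add: cong_iff_dvd_diff)
    hence "?p dvd b * (a * c - d) - a * (b * c - 1)" using d(2)
      by (rule dvd_diff[OF dvd_mult dvd_mult, rotated])
    thus ?thesis by (simp add: algebra_simps)
  qed
  hence 1: "Fin 1 \<le> padic_val (of_int (a - b * d) :: 'p padic)" by (rule padic_val_of_int_ge_1)
  have vb: "padic_val (of_int b :: 'p padic) = Fin 0"
    using b \<open>\<not> ?p dvd b\<close> by (simp add: padic_val_of_int not_dvd_imp_multiplicity_0)
  have "of_rat q - of_int d = of_int (a - b * d) * inverse (of_int b :: 'p padic)"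
    using b(1) unfolding b(3) of_rat_divide by (simp add: field_simps)
  hence "Fin 1 \<le> padic_val (of_rat q - of_int d :: 'p padic)"
    using padic_val_ge_mult[OF 1, of 0 "inverse (of_int b)"] padic_val_inverse[OF vb] by simp
  with q have "Fin 1 \<le> padic_val ((x - of_rat q) + (of_rat q - of_int d))"
    by (rule padic_val_ge_add)
  thus ?thesis using d(1) by auto
qed

lemma signed_digit_bound_iff:
  "- real p / 2 < real_of_int d \<and> real_of_int d < real p / 2 \<longleftrightarrow> 2 * \<bar>d\<bar> < int p"
  by linarith

text \<open>Digits are peeled off greedily after scaling \<open>\<alpha>\<close> to be integral:
  subtract the symmetric residue, divide by \<open>p\<close>, repeat.\<close>

lemma signed_expansion_exists:
  fixes \<alpha> :: "'p::prime_card padic"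
  assumes p: "odd CARD('p)"
  shows "\<exists>k x. signed_expansion \<alpha> k x"
proof -
  let ?p = "of_nat CARD('p) :: 'p padic"
  have p0: "?p \<noteq> 0" and p1: "1 < real CARD('p)"
    using prime_gt_1_nat[OF prime_card[where 'a='p]] by auto
  \<comment> \<open>Any lower bound for the valuation will do, which also covers
    \<open>\<alpha> = 0\<close>; leading digits may vanish.\<close>
  obtain k where k: "Fin k \<le> padic_val \<alpha>"
    by (cases "padic_val \<alpha>") auto
  obtain digit :: "'p padic \<Rightarrow> int" where digit:
    "\<And>x. Fin 0 \<le> padic_val x \<Longrightarrow> 2 * \<bar>digit x\<bar> < int CARD('p)"
    "\<And>x. Fin 0 \<le> padic_val x \<Longrightarrow> Fin 1 \<le> padic_val (x - of_int (digit x))"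
    using padic_signed_digit[OF p] by metis
  define \<gamma> where "\<gamma> = rec_nat (\<alpha> * ?p powi (- k)) (\<lambda>_ x. (x - of_int (digit x)) * ?p powi (- 1))"
  have \<gamma>_Suc: "\<gamma> (Suc i) = (\<gamma> i - of_int (digit (\<gamma> i))) * ?p powi (- 1)" for i
    by (simp add: \<gamma>_def)
  have \<gamma>: "Fin 0 \<le> padic_val (\<gamma> i)" for i
  proof (induction i)
    case 0
    show ?case
      using padic_val_ge_mult[OF k, of "- k" "?p powi (- k)"] by (simp add: \<gamma>_def padic_val_p_powi)
  next
    case (Suc i)
    show ?case
      using padic_val_ge_mult[OF digit(2)[OF Suc], of "- 1" "?p powi (- 1)"]
      unfolding \<gamma>_Suc by (simp add: padic_val_p_powi del: power_int_minus1_right)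
  qed
  define x where "x j = digit (\<gamma> (nat (j - k)))" for j
  let ?S = "\<lambda>n. \<Sum>i<n. of_int (x (k + int i)) * ?p powi (k + int i)"
  \<comment> \<open>Since every \<open>\<gamma> n\<close> is integral, this exact remainder has
    valuation at least \<open>k + n\<close>, which yields the geometric bound on the
    distance.\<close>
  have S: "\<alpha> - ?S n = \<gamma> n * ?p powi (k + int n)" for n
  proof (induction n)
    case 0
    show ?case using p0 by (simp add: \<gamma>_def power_int_minus)
  next
    case (Suc n)
    have "\<alpha> - ?S (Suc n) = (\<gamma> n - of_int (digit (\<gamma> n))) * ?p powi (k + int n)"
      using Suc by (simp add: x_def algebra_simps)
    also have "\<dots> = \<gamma> (Suc n) * ?p powi (k + int (Suc n))"
      using p0 by (simp add: \<gamma>_Suc power_int_add field_simps)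
    finally show ?case .
  qed
  have bound: "dist (?S n) \<alpha> \<le> real CARD('p) powi (- k) * inverse (real CARD('p)) ^ n" for n
  proof -
    have "Fin (k + int n) \<le> padic_val (\<alpha> - ?S n)"
      using padic_val_ge_mult[OF \<gamma>[of n], of "k + int n" "?p powi (k + int n)"]
      by (simp add: S padic_val_p_powi)
    hence "dist (?S n) \<alpha> \<le> real CARD('p) powi (- (k + int n))"
      unfolding dist_padic_le_iff by (simp add: padic_val_diff_commute)
    also have "\<dots> = real CARD('p) powi (- k) * inverse (real CARD('p)) ^ n"
      using p1 by (simp add: power_int_diff power_int_minus field_simps)
    finally show ?thesis .
  qed
  have "(\<lambda>n. real CARD('p) powi (- k) * inverse (real CARD('p)) ^ n) \<longlonglongrightarrow> real CARD('p) powi (- k) * 0"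
    using p1 by (intro tendsto_mult tendsto_const LIMSEQ_power_zero) (simp add: field_simps)
  hence lim: "(\<lambda>n. real CARD('p) powi (- k) * inverse (real CARD('p)) ^ n) \<longlonglongrightarrow> 0" by simp
  have "(\<lambda>n. dist (?S n) \<alpha>) \<longlonglongrightarrow> 0"
    by (rule tendsto_sandwich[OF always_eventually always_eventually tendsto_const lim])
       (use bound in simp_all)
  hence "(\<lambda>i. of_int (x (k + int i)) * ?p powi (k + int i)) sums \<alpha>"
    unfolding sums_def by (subst tendsto_dist_iff)
  moreover have "2 * \<bar>x j\<bar> < int CARD('p)" for j
    unfolding x_def by (intro digit \<gamma>)
  ultimately have "signed_expansion \<alpha> k x"
    unfolding signed_expansion_def signed_digit_bound_iff by blast
  thus ?thesis by blast
qed

text \<open>A late partial sum is within valuation 1 of \<open>\<alpha>\<close>, and the terms it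
  has beyond the truncation carry positive powers of \<open>p\<close>.\<close>

lemma signed_expansion_trunc_val:
  fixes \<alpha> :: "'p::prime_card padic"
  assumes "signed_expansion \<alpha> k x"
  shows "Fin 1 \<le> padic_val (\<alpha> - (\<Sum>j=k..0. of_int (x j) * of_nat CARD('p) powi j))"
proof -
  let ?t = "\<lambda>j. of_int (x j) * of_nat CARD('p) powi j :: 'p padic"
  let ?S = "\<lambda>n. \<Sum>i<n. ?t (k + int i)"
  have p1: "1 < real CARD('p)" using prime_gt_1_nat[OF prime_card[where 'a='p]] by simp
  have "?S \<longlonglongrightarrow> \<alpha>" using assms unfolding signed_expansion_def sums_def by blast
  moreover have "real CARD('p) powi (- 1) > 0" using p1 by simp
  ultimately obtain M where M: "\<And>n. n \<ge> M \<Longrightarrow> dist (?S n) \<alpha> < real CARD('p) powi (- 1)"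
    unfolding lim_sequentially by blast
  \<comment> \<open>The bound \<open>1 - k\<close> makes the partial sum reach exponent 0.\<close>
  define n where "n = max M (nat (1 - k))"
  have "Fin 1 \<le> padic_val (?S n - \<alpha>)"
    using M[of n] unfolding n_def by (subst dist_padic_le_iff[symmetric]) simp
  hence 1: "Fin 1 \<le> padic_val (\<alpha> - ?S n)" by (simp add: padic_val_diff_commute)
  have "?S n = (\<Sum>j\<in>{k..<k + int n}. ?t j)"
    by (rule sum.reindex_bij_witness[of _ "\<lambda>j. nat (j - k)" "\<lambda>i. k + int i"]) auto
  \<comment> \<open>For \<open>k > 0\<close> the interval \<open>{k..0}\<close> is empty and
    \<open>max k 1 = k\<close>.\<close>
  also have "{k..<k + int n} = {k..0} \<union> {max k 1..<k + int n}"
    unfolding n_def by auto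
  also have "(\<Sum>j\<in>\<dots>. ?t j) = (\<Sum>j=k..0. ?t j) + (\<Sum>j\<in>{max k 1..<k + int n}. ?t j)"
    by (rule sum.union_disjoint) auto
  finally have split: "?S n - (\<Sum>j=k..0. ?t j) = (\<Sum>j\<in>{max k 1..<k + int n}. ?t j)" by simp
  have "Fin 1 \<le> padic_val (?t j)" if "j \<ge> 1" for j
  proof -
    have "Fin (0 + j) \<le> padic_val (?t j)"
      by (rule padic_val_ge_mult) (simp_all add: padic_val_of_int_nonneg padic_val_p_powi)
    thus ?thesis using that order_trans[of "Fin 1" "Fin j"] by simp
  qed
  hence "Fin 1 \<le> padic_val (?S n - (\<Sum>j=k..0. ?t j))"
    unfolding split by (intro padic_val_ge_sum) auto
  from padic_val_ge_add[OF 1 this] show ?thesis by simp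
qed

text \<open>Twice a digit is at most \<open>p - 1\<close> in absolute value, so twice the numerator
  is bounded by a geometric sum equal to \<open>p ^ Suc m - 1\<close>.\<close>

lemma signed_expansion_trunc_fraction:
  fixes \<alpha> :: "'p::prime_card padic"
  assumes "signed_expansion \<alpha> k x" and m: "- k \<le> int m"
  shows "\<exists>N::int. 2 * \<bar>N\<bar> < int CARD('p) ^ Suc m \<and>
    (\<Sum>j=k..0. of_int (x j) * of_nat CARD('p) powi j :: 'p padic) * of_nat CARD('p) ^ m = of_int N"
proof -
  let ?p = "int CARD('p)"
  have p0: "(of_nat CARD('p) :: 'p padic) \<noteq> 0" and p1: "1 < ?p"
    using prime_gt_1_nat[OF prime_card[where 'a='p]] by auto
  \<comment> \<open>Digits shifted by \<open>m\<close>, so that exponents become natural numbers,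
    and padded with 0 below \<open>k\<close>.\<close>
  define y where "y i = (if k \<le> int i - int m then x (int i - int m) else 0)" for i :: nat
  define N where "N = (\<Sum>i\<le>m. y i * ?p ^ i)"
  have "2 * \<bar>x j\<bar> < ?p" if "j \<ge> k" for j
    using assms(1) that unfolding signed_expansion_def signed_digit_bound_iff by blast
  hence y: "2 * \<bar>y i\<bar> \<le> ?p - 1" for i
    using p1 by (auto simp: y_def zle_diff1_eq)
  have "2 * \<bar>N\<bar> \<le> (\<Sum>i\<le>m. (?p - 1) * ?p ^ i)"
  proof -
    have "2 * \<bar>N\<bar> \<le> 2 * (\<Sum>i\<le>m. \<bar>y i * ?p ^ i\<bar>)" unfolding N_def by (simp add: sum_abs)
    also have "\<dots> = (\<Sum>i\<le>m. (2 * \<bar>y i\<bar>) * ?p ^ i)"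
      by (simp add: sum_distrib_left abs_mult mult_ac)
    also have "\<dots> \<le> (\<Sum>i\<le>m. (?p - 1) * ?p ^ i)"
      by (intro sum_mono mult_right_mono y) auto
    finally show ?thesis .
  qed
  also have "\<dots> = ?p ^ Suc m - 1"
    by (simp only: sum_distrib_left[symmetric] power_diff_1_eq[of ?p "Suc m"] lessThan_Suc_atMost)
  finally have bound: "2 * \<bar>N\<bar> < ?p ^ Suc m" by simp
  have "(\<Sum>j=k..0. of_int (x j) * of_nat CARD('p) powi j :: 'p padic) * of_nat CARD('p) ^ m
      = (\<Sum>j=k..0. of_int (x j) * of_nat CARD('p) powi (j + int m))"
    using p0 by (simp add: sum_distrib_right power_int_add mult.assoc)
  also have "\<dots> = (\<Sum>i\<in>{i. i \<le> m \<and> k \<le> int i - int m}. of_int (y i) * of_nat CARD('p) ^ i)"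
    by (rule sum.reindex_bij_witness[of _ "\<lambda>i. int i - int m" "\<lambda>j. nat (j + int m)"])
       (use m in \<open>auto simp: y_def power_int_def\<close>)
  also have "\<dots> = (\<Sum>i\<le>m. of_int (y i) * of_nat CARD('p) ^ i)"
    by (rule sum.mono_neutral_left) (auto simp: y_def)
  also have "\<dots> = of_int N" by (simp add: N_def)
  finally show ?thesis using bound by blast
qed

text \<open>Scaled by \<open>p ^ m\<close>, both truncations become integers smaller than \<open>p ^ (m + 1) / 2\<close> in absolute value
  whose difference is divisible by \<open>p ^ (m + 1)\<close>.\<close>

lemma signed_expansion_trunc_unique:
  fixes \<alpha> :: "'p::prime_card padic"
  assumes "signed_expansion \<alpha> k x" "signed_expansion \<alpha> k' x'"
  shows "(\<Sum>j=k..0. of_int (x j) * of_nat CARD('p) powi j :: 'p padic)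
    = (\<Sum>j=k'..0. of_int (x' j) * of_nat CARD('p) powi j)" (is "?y = ?y'")
proof -
  let ?p = "of_nat CARD('p) :: 'p padic"
  obtain m :: nat where m: "- k \<le> int m" "- k' \<le> int m"
    by (metis max.bounded_iff nat_le_iff order_refl)
  obtain N where N: "2 * \<bar>N\<bar> < int CARD('p) ^ Suc m" "?y * ?p ^ m = of_int N"
    using signed_expansion_trunc_fraction[OF assms(1) m(1)] by blast
  obtain N' where N': "2 * \<bar>N'\<bar> < int CARD('p) ^ Suc m" "?y' * ?p ^ m = of_int N'"
    using signed_expansion_trunc_fraction[OF assms(2) m(2)] by blast
  have "Fin 1 \<le> padic_val ((\<alpha> - ?y') - (\<alpha> - ?y))"
    by (intro padic_val_ge_diff signed_expansion_trunc_val assms)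
  hence "Fin (1 + int m) \<le> padic_val ((?y - ?y') * ?p ^ m)"
    by (intro padic_val_ge_mult) (simp_all add: padic_val_p_power)
  also have "(?y - ?y') * ?p ^ m = of_int (N - N')"
    using N N' by (simp add: left_diff_distrib)
  finally have "int CARD('p) ^ Suc m dvd N - N'"
    by (intro power_dvd_if_padic_val_ge) simp
  moreover have "\<bar>N - N'\<bar> < int CARD('p) ^ Suc m" using N N' by linarith
  ultimately have "N = N'" using zdvd_imp_le[of _ "\<bar>N - N'\<bar>"] by fastforce
  hence "?y * ?p ^ m = ?y' * ?p ^ m" using N N' by simp
  thus ?thesis by simp
qed

text \<open>Existence of an expansion and uniqueness of its truncation make the \<open>THE\<close>
  in \<open>browkin_s\<close> well defined. Later arguments use \<open>browkin_s\<close> only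
  through this congruence.\<close>

lemma padic_val_minus_browkin_s:
  fixes \<alpha> :: "'p::prime_card padic"
  assumes p: "odd CARD('p)"
  shows "Fin 1 \<le> padic_val (\<alpha> - browkin_s \<alpha>)"
proof -
  obtain k x where kx: "signed_expansion \<alpha> k x" using signed_expansion_exists[OF p] by blast
  have "browkin_s \<alpha> = (\<Sum>j=k..0. of_int (x j) * of_nat CARD('p) powi j)"
    unfolding browkin_s_def
    by (rule the_equality) (use kx signed_expansion_trunc_unique[OF _ kx] in blast)+
  thus ?thesis using signed_expansion_trunc_val[OF kx] by simp
qed

section \<open>The Jacobi--Perron algorithm\<close>

lemma jp_state_Suc:
  assumes "mcf_defined \<alpha> \<beta> (Suc n)"
  obtains x y where "jp_state \<alpha> \<beta> n = Some (x, y)" "y \<noteq> browkin_s y"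
    "jp_state \<alpha> \<beta> (Suc n) = Some (1 / (y - browkin_s y), (x - browkin_s x) / (y - browkin_s y))"
  using assms by (auto simp: mcf_defined_def split: option.splits if_splits)

lemma mcf_defined_SucD: "mcf_defined \<alpha> \<beta> (Suc n) \<Longrightarrow> mcf_defined \<alpha> \<beta> n"
  by (erule jp_state_Suc) (simp add: mcf_defined_def)

lemma mcf_defined_mono: "mcf_defined \<alpha> \<beta> n \<Longrightarrow> m \<le> n \<Longrightarrow> mcf_defined \<alpha> \<beta> m"
  by (induction n) (auto simp: le_Suc_eq dest: mcf_defined_SucD)

text \<open>Here \<open>k\<close> is the valuation of \<open>y - browkin_s y\<close> at the
  preceding index. Division by this difference gives the first complete quotient valuation
  \<open>- k\<close>; the second gains at least 1 from the numerator \<open>x - browkin_s x\<close>.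
  Since \<open>b\<close> may vanish, only a lower bound is available for it.\<close>

lemma mcf_partial_quotients_val:
  fixes \<alpha> \<beta> :: "'p::prime_card padic"
  assumes p: "odd CARD('p)" and "mcf_defined \<alpha> \<beta> (Suc n)"
  obtains k where "k \<ge> 1" "padic_val (mcf_a \<alpha> \<beta> (Suc n)) = Fin (- k)"
    "Fin (1 - k) \<le> padic_val (mcf_b \<alpha> \<beta> (Suc n))"
proof -
  obtain x y where xy: "y \<noteq> browkin_s y"
    "jp_state \<alpha> \<beta> (Suc n) = Some (1 / (y - browkin_s y), (x - browkin_s x) / (y - browkin_s y))"
    using assms(2) by (rule jp_state_Suc)
  define x' y' where "x' = inverse (y - browkin_s y)" and "y' = (x - browkin_s x) * x'"
  have ab: "mcf_a \<alpha> \<beta> (Suc n) = browkin_s x'" "mcf_b \<alpha> \<beta> (Suc n) = browkin_s y'"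
    using xy by (simp_all add: mcf_a_def mcf_b_def x'_def y'_def divide_inverse del: jp_state.simps)
  note s = padic_val_minus_browkin_s[OF p]
  obtain k where k: "padic_val (y - browkin_s y) = Fin k"
    using xy(1) padic_val_nonzero[of "y - browkin_s y"] by auto
  have k1: "k \<ge> 1" using s[of y] k by simp
  have x': "padic_val x' = Fin (- k)" unfolding x'_def by (rule padic_val_inverse[OF k])
  \<comment> \<open>The correction \<open>browkin_s x' - x'\<close> has valuation at least 1, too
    large to change the negative valuation of \<open>x'\<close>.\<close>
  have "padic_val x' < Fin 1" using x' k1 by simp
  also have "\<dots> \<le> padic_val (browkin_s x' - x')"
    using s[of x'] by (simp add: padic_val_diff_commute)
  finally have a: "padic_val (browkin_s x') = Fin (- k)" using padic_val_eqI x' by metis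
  have "Fin (1 - k) \<le> padic_val y'"
    using padic_val_ge_mult[OF s, of "- k" x' x] by (simp add: y'_def x')
  moreover have "Fin (1 - k) \<le> padic_val (y' - browkin_s y')"
    using k1 by (intro order_trans[OF _ s]) simp
  ultimately have "Fin (1 - k) \<le> padic_val (y' - (y' - browkin_s y'))"
    by (rule padic_val_ge_diff)
  thus ?thesis using that[of k] k1 a by (simp add: ab)
qed

text \<open>In particular the denominators are nonzero, so the convergents are genuine
  quotients.\<close>

lemma mcf_C_val:
  fixes \<alpha> \<beta> :: "'p::prime_card padic"
  assumes p: "odd CARD('p)" and "mcf_defined \<alpha> \<beta> n"
  obtains K where "mcf_K \<alpha> \<beta> n = Fin K" "padic_val (mcf_C \<alpha> \<beta> n) = Fin (- K)"
proof -
  define c where "c = mcf_rec (mcf_a \<alpha> \<beta>) (mcf_b \<alpha> \<beta>) 0 0 1"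
  \<comment> \<open>By the index shift these terms are \<open>C\<close> at \<open>n\<close>,
    \<open>n - 1\<close> and \<open>n - 2\<close>. The strict gap for the two older ones keeps the
    leading term dominant; initially both are 0.\<close>
  have "\<exists>K. mcf_K \<alpha> \<beta> n = Fin K \<and> padic_val (c (n + 2)) = Fin (- K) \<and>
    Fin (1 - K) \<le> padic_val (c (n + 1)) \<and> Fin (1 - K) \<le> padic_val (c n)"
    using assms(2)
  proof (induction n)
    case 0
    show ?case by (simp add: c_def mcf_K_def zero_extended_def numeral_2_eq_2)
  next
    case (Suc n)
    let ?a = "mcf_a \<alpha> \<beta> (Suc n)" and ?b = "mcf_b \<alpha> \<beta> (Suc n)"
    obtain K where K: "mcf_K \<alpha> \<beta> n = Fin K" "padic_val (c (n + 2)) = Fin (- K)"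
      "Fin (1 - K) \<le> padic_val (c (n + 1))" "Fin (1 - K) \<le> padic_val (c n)"
      using Suc mcf_defined_SucD by blast
    obtain k where k: "k \<ge> 1" "padic_val ?a = Fin (- k)" "Fin (1 - k) \<le> padic_val ?b"
      by (rule mcf_partial_quotients_val[OF p Suc.prems])
    have "mcf_K \<alpha> \<beta> (Suc n) = mcf_K \<alpha> \<beta> n + padic_val (1 / ?a)"
      by (simp add: mcf_K_def)
    hence K': "mcf_K \<alpha> \<beta> (Suc n) = Fin (K + k)"
      using K(1) padic_val_inverse[OF k(2)] by (simp add: inverse_eq_divide)
    have rec: "c (Suc n + 2) - ?a * c (n + 2) = ?b * c (n + 1) + c n"
      by (simp add: c_def numeral_2_eq_2)
    have lead: "padic_val (?a * c (n + 2)) = Fin (- (K + k))"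
      unfolding padic_val_mult k K by simp
    \<comment> \<open>The product even has valuation at least \<open>2 - (K + k)\<close>.\<close>
    have "Fin (1 - (K + k)) \<le> padic_val (?b * c (n + 1))"
      by (rule order_trans[OF _ padic_val_ge_mult[OF k(3) K(3)]]) simp
    moreover have "Fin (1 - (K + k)) \<le> padic_val (c n)"
      using k by (intro order_trans[OF _ K(4)]) simp
    ultimately have "Fin (1 - (K + k)) \<le> padic_val (c (Suc n + 2) - ?a * c (n + 2))"
      unfolding rec by (rule padic_val_ge_add)
    moreover have "padic_val (?a * c (n + 2)) < Fin (1 - (K + k))" unfolding lead by simp
    ultimately have "padic_val (c (Suc n + 2)) = Fin (- (K + k))"
      using padic_val_eqI lead by (metis less_le_trans)
    moreover have "Fin (1 - (K + k)) \<le> padic_val (c (Suc n + 1))" using K(2) k by simp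
    moreover have "Fin (1 - (K + k)) \<le> padic_val (c (Suc n))"
      using k K(3) by (simp add: order_trans[of "Fin (1 - (K + k))" "Fin (1 - K)"])
    ultimately show ?case using K' by blast
  qed
  thus ?thesis using that by (auto simp: c_def mcf_C_def)
qed

text \<open>In the induction step, the hypothesis divided by \<open>v - browkin_s v\<close>, for the complete quotients
  \<open>(u, v)\<close> of index \<open>n\<close>, says that \<open>V\<close> is annihilated by those of index \<open>n + 1\<close>.\<close>

lemma mcf_residual_recurrence:
  assumes rec: "\<And>i. V (Suc (Suc (Suc i))) =
      mcf_a \<alpha> \<beta> (Suc i) * V (Suc (Suc i)) + mcf_b \<alpha> \<beta> (Suc i) * V (Suc i) + V i"
    and base: "V (Suc (Suc 0)) = (browkin_s \<alpha> - \<alpha>) * V (Suc 0) + (browkin_s \<beta> - \<beta>) * V 0"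
    and "jp_state \<alpha> \<beta> n = Some (x, y)"
  shows "V (Suc (Suc n)) = (browkin_s x - x) * V (Suc n) + (browkin_s y - y) * V n"
  using assms(3)
proof (induction n arbitrary: x y)
  case 0
  thus ?case using base by simp
next
  case (Suc n)
  obtain u v where uv: "jp_state \<alpha> \<beta> n = Some (u, v)" "v \<noteq> browkin_s v"
    and "jp_state \<alpha> \<beta> (Suc n) = Some (1 / (v - browkin_s v), (u - browkin_s u) / (v - browkin_s v))"
    using jp_state_Suc[of \<alpha> \<beta> n] Suc.prems by (metis mcf_defined_def option.distinct(1))
  hence xy: "x = 1 / (v - browkin_s v)" "y = (u - browkin_s u) / (v - browkin_s v)"
    using Suc.prems by simp_all
  have d: "v - browkin_s v \<noteq> 0" using uv by simp
  have "x * V (Suc (Suc n)) + y * V (Suc n) + V n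
      = (V (Suc (Suc n)) + (u - browkin_s u) * V (Suc n) + (v - browkin_s v) * V n) / (v - browkin_s v)"
    using d unfolding xy by (simp add: add_divide_distrib)
  also have "\<dots> = 0" unfolding Suc.IH[OF uv(1)] by (simp add: algebra_simps)
  finally have rel: "x * V (Suc (Suc n)) + y * V (Suc n) + V n = 0" .
  have ab: "mcf_a \<alpha> \<beta> (Suc n) = browkin_s x" "mcf_b \<alpha> \<beta> (Suc n) = browkin_s y"
    using Suc.prems by (simp_all add: mcf_a_def mcf_b_def del: jp_state.simps)
  \<comment> \<open>Subtracting the vanishing expression \<open>rel\<close> cancels
    \<open>V n\<close> and leaves coefficients of valuation at least 1.\<close>
  have "V (Suc (Suc (Suc n))) = browkin_s x * V (Suc (Suc n)) + browkin_s y * V (Suc n) + V n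
      - (x * V (Suc (Suc n)) + y * V (Suc n) + V n)"
    unfolding rel rec ab by simp
  thus ?case by (simp add: algebra_simps)
qed

text \<open>The offset \<open>c\<close> lets one induction serve both coordinates: 0 for
  \<open>\<alpha>\<close> and 1 for \<open>\<beta>\<close>, whose residuals start
  differently.\<close>

lemma mcf_residual_val:
  fixes \<alpha> \<beta> :: "'p::prime_card padic"
  assumes p: "odd CARD('p)"
    and rec: "\<And>i. V (Suc (Suc (Suc i))) =
      mcf_a \<alpha> \<beta> (Suc i) * V (Suc (Suc i)) + mcf_b \<alpha> \<beta> (Suc i) * V (Suc i) + V i"
    and base: "V (Suc (Suc 0)) = (browkin_s \<alpha> - \<alpha>) * V (Suc 0) + (browkin_s \<beta> - \<beta>) * V 0"
    and V0: "Fin (c div 2) \<le> padic_val (V 0)" and V1: "Fin ((1 + c) div 2) \<le> padic_val (V (Suc 0))"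
    and "mcf_defined \<alpha> \<beta> n"
  shows "Fin ((int (n + 2) + c) div 2) \<le> padic_val (V (n + 2))"
proof -
  have "i \<le> n + 2 \<Longrightarrow> Fin ((int i + c) div 2) \<le> padic_val (V i)" for i
  proof (induction i rule: less_induct)
    case (less i)
    consider "i = 0" | "i = Suc 0" | m where "i = Suc (Suc m)" by (metis not0_implies_Suc)
    thus ?case
    proof cases
      case 3
      have "mcf_defined \<alpha> \<beta> m" using mcf_defined_mono[OF assms(6)] less.prems 3 by simp
      then obtain x y where xy: "jp_state \<alpha> \<beta> m = Some (x, y)" by (auto simp: mcf_defined_def)
      have s: "Fin 1 \<le> padic_val (browkin_s z - z)" for z :: "'p padic"
        using padic_val_minus_browkin_s[OF p, of z] by (simp add: padic_val_diff_commute)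
      let ?h = "(int m + c) div 2"
      have m: "Fin ?h \<le> padic_val (V m)" using less 3 by simp
      \<comment> \<open>The newer residual also satisfies the weaker bound of the older one, so both
        products gain 1 over the same \<open>?h\<close>.\<close>
      have "Fin ?h \<le> Fin ((int (Suc m) + c) div 2)" by (simp add: zdiv_mono1)
      also have "\<dots> \<le> padic_val (V (Suc m))" using less.IH[of "Suc m"] less.prems 3 by simp
      finally have "Fin (1 + ?h) \<le> padic_val (V (Suc (Suc m)))"
        unfolding mcf_residual_recurrence[of V, OF rec base xy]
        using s m by (intro padic_val_ge_add padic_val_ge_mult)
      moreover have "(int i + c) div 2 = 1 + ?h" using 3 by simp
      ultimately show ?thesis using 3 by simp
    qed (use V0 V1 in simp_all)
  qed
  thus ?thesis by blast
qed

text \<open>The error is, up to sign, the residual divided by \<open>c\<close>, and this division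
  adds \<open>K\<close>.\<close>

lemma padic_val_diff_quotient:
  assumes "padic_val c = Fin (- K)" "Fin N \<le> padic_val (a - x * c)"
  shows "Fin (K + N) \<le> padic_val (x - a / c)"
proof -
  have "c \<noteq> 0" using assms(1) by auto
  hence "x - a / c = - (inverse c * (a - x * c))" by (simp add: field_simps)
  thus ?thesis
    using padic_val_ge_mult[OF _ assms(2), of K "inverse c"] padic_val_inverse[OF assms(1)] by simp
qed

theorem theorem2:
  fixes \<alpha> \<beta> :: "'p::prime_card padic" and n :: nat
  assumes "odd CARD('p)"
    and "mcf_defined \<alpha> \<beta> n"
  shows "padic_val (\<alpha> - convergent_alpha \<alpha> \<beta> n) \<ge> mcf_K \<alpha> \<beta> n + Fin \<lfloor>(real n + 2) / 2\<rfloor> \<and>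
         padic_val (\<beta> - convergent_beta \<alpha> \<beta> n) \<ge> mcf_K \<alpha> \<beta> n + Fin \<lfloor>(real n + 3) / 2\<rfloor>"
proof -
  let ?rec = "mcf_rec (mcf_a \<alpha> \<beta>) (mcf_b \<alpha> \<beta>)"
  obtain K where K: "mcf_K \<alpha> \<beta> n = Fin K" "padic_val (mcf_C \<alpha> \<beta> n) = Fin (- K)"
    by (rule mcf_C_val[OF assms])
  have 0: "mcf_a \<alpha> \<beta> 0 = browkin_s \<alpha>" "mcf_b \<alpha> \<beta> 0 = browkin_s \<beta>"
    by (simp_all add: mcf_a_def mcf_b_def)
  \<comment> \<open>The summands \<open>+ 0\<close> and \<open>+ 1\<close> are kept to match the
    offset \<open>c\<close> of \<open>mcf_residual_val\<close>.\<close>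
  have fl: "\<lfloor>(real n + 2) / 2\<rfloor> = (int (n + 2) + 0) div 2"
    "\<lfloor>(real n + 3) / 2\<rfloor> = (int (n + 2) + 1) div 2"
    using floor_divide_of_int_eq[of "int n + 2" 2, where 'a=real]
      floor_divide_of_int_eq[of "int n + 3" 2, where 'a=real] by simp_all
  \<comment> \<open>The first two residuals are 0 and 1, of valuations \<open>Pinf\<close> and 0;
    the second one forces \<open>c = 0\<close>.\<close>
  have "Fin ((int (n + 2) + 0) div 2) \<le> padic_val (mcf_A \<alpha> \<beta> n - \<alpha> * mcf_C \<alpha> \<beta> n)"
    unfolding mcf_A_def mcf_C_def
    by (rule mcf_residual_val[where V = "\<lambda>i. ?rec 0 1 (mcf_a \<alpha> \<beta> 0) i - \<alpha> * ?rec 0 0 1 i", OF assms(1) _ _ _ _ assms(2)])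
       (simp_all add: 0 algebra_simps zero_extended_def)
  \<comment> \<open>Now the first two residuals are 1 and 0. The vanishing second one allows
    \<open>c = 1\<close>, which accounts for the larger floor in the bound for
    \<open>\<beta>\<close>.\<close>
  moreover have "Fin ((int (n + 2) + 1) div 2) \<le> padic_val (mcf_B \<alpha> \<beta> n - \<beta> * mcf_C \<alpha> \<beta> n)"
    unfolding mcf_B_def mcf_C_def
    by (rule mcf_residual_val[where V = "\<lambda>i. ?rec 1 0 (mcf_b \<alpha> \<beta> 0) i - \<beta> * ?rec 0 0 1 i", OF assms(1) _ _ _ _ assms(2)])
       (simp_all add: 0 algebra_simps zero_extended_def)
  ultimately show ?thesis
    unfolding convergent_alpha_def convergent_beta_def fl K(1) plus_extended.simps
    by (intro conjI padic_val_diff_quotient K(2))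
qed

end
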